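(* Let $(X,b,m)$ be a weighted graph satisfying $\sum_{y\in X}b^2(x,y)/m(y)<\infty$ for every $x\in X$. Let $X_1\subseteq X$, $X_2=X\setminus X_1$ and $X_3=\partial X_1\cup\partial X_2$ be such that $\mathrm{Deg}_\partial$ is a bounded function on $X_3$. Then $L_c$ is essentially self-adjoint if and only if both $L_{c,1}$ and $L_{c,2}$ are essentially self-adjoint.
   Context: A weighted graph $(X,b,m)$ consists of a countably infinite set $X$, a symmetric $b\colon X\times X\to[0,\infty)$ vanishing on the diagonal with $\sum_y b(x,y)<\infty$ for all $x$, and $m\colon X\to(0,\infty)$. All functions are real-valued; $\ell^2(X,m)$ has inner product $\langle f,g\rangle=\sum_x f(x)g(x)m(x)$. The formal Laplacian is $\Delta f(x)=\frac1{m(x)}\sum_y b(x,y)(f(x)-f(y))$ for $f$ with $\sum_y b(x,y)|f(y)|<\infty$ for all $x$. $C_c(X)$ is the set of finitely supported functions; under the summability hypothesis of the claim, $L_c=\Delta|_{C_c(X)}$ is a symmetric positive operator on $\ell^2(X,m)$. An operator is essentially self-adjoint if it has a unique self-adjoint extension (equivalently, its closure is self-adjoint). For $K\subseteq X$, $\partial K=\{x\in K\mid \text{there exists } y\notin K\text{ with } b(x,y)>0\}$. For $k=1,2$, $(X_k,b_k,m_k)$ is the induced subgraph ($b$ restricted to $X_k\times X_k$, $m$ restricted to $X_k$; $X_k$ may be finite), $\Delta_k$ its formal Laplacian, and $L_{c,k}=\Delta_k|_{C_c(X_k)}$ as an operator on $\ell^2(X_k,m_k)$. On $X_3\times X_3$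 let $b_\partial(x,y)=b(x,y)$ if one of $x,y$ lies in $X_1$ and the other in $X_2$, and $b_\partial(x,y)=0$ otherwise. For $x\in X_3$, $\mathrm{Deg}_\partial(x)=\frac1{m(x)}\sum_{y\in X_3}b_\partial(x,y)$. *)

theory Defs
  imports "HOL-Analysis.Analysis"
begin

locale weighted_graph =
  fixes X :: "'a set" and b :: "'a \<Rightarrow> 'a \<Rightarrow> real" and m :: "'a \<Rightarrow> real"
  assumes countable_X: "countable X"
    and infinite_X: "infinite X"
    and b_nonneg: "\<And>x y. x \<in> X \<Longrightarrow> y \<in> X \<Longrightarrow> b x y \<ge> 0"
    and b_sym: "\<And>x y. x \<in> X \<Longrightarrow> y \<in> X \<Longrightarrow> b x y = b y x"
    and b_diag: "\<And>x. x \<in> X \<Longrightarrow> b x x = 0"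
    and b_summable: "\<And>x. x \<in> X \<Longrightarrow> b x summable_on X"
    and m_pos: "\<And>x. x \<in> X \<Longrightarrow> m x > 0"

text \<open>
  The space \<open>\<ell>\<^sup>2(V, m)\<close>. Real functions on a set \<open>V\<close> are represented by functions on the
  ambient type that vanish outside \<open>V\<close>, so that equality of functions on \<open>V\<close> is
  plain equality.
\<close>

definition ell2 :: "'a set \<Rightarrow> ('a \<Rightarrow> real) \<Rightarrow> ('a \<Rightarrow> real) set" where
  "ell2 V m = {f. (\<forall>x. x \<notin> V \<longrightarrow> f x = 0) \<and> (\<lambda>x. (f x)\<^sup>2 * m x) summable_on V}"

definition ell2_inner :: "'a set \<Rightarrow> ('a \<Rightarrow> real) \<Rightarrow> ('a \<Rightarrow> real) \<Rightarrow> ('a \<Rightarrow> real) \<Rightarrow> real" where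
  "ell2_inner V m f g = (\<Sum>\<^sub>\<infinity>x\<in>V. f x * g x * m x)"

definition ell2_norm :: "'a set \<Rightarrow> ('a \<Rightarrow> real) \<Rightarrow> ('a \<Rightarrow> real) \<Rightarrow> real" where
  "ell2_norm V m f = sqrt (ell2_inner V m f f)"

text \<open>
  Unbounded operators on \<open>\<ell>\<^sup>2(V, m)\<close> are identified with their graphs, so that
  extension is inclusion and equality of operators includes equality of domains;
  the domain of \<open>T\<close> is \<^term>\<open>Domain T\<close>.
\<close>

type_synonym 'a operator = "(('a \<Rightarrow> real) \<times> ('a \<Rightarrow> real)) set"

definition linear_operator :: "'a set \<Rightarrow> ('a \<Rightarrow> real) \<Rightarrow> 'a operator \<Rightarrow> bool" where
  "linear_operator V m T \<longleftrightarrow>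
     T \<subseteq> ell2 V m \<times> ell2 V m \<and> single_valued T \<and>
     (\<lambda>x. 0, \<lambda>x. 0) \<in> T \<and>
     (\<forall>f g f' g'. (f, g) \<in> T \<longrightarrow> (f', g') \<in> T \<longrightarrow> (\<lambda>x. f x + f' x, \<lambda>x. g x + g' x) \<in> T) \<and>
     (\<forall>c f g. (f, g) \<in> T \<longrightarrow> (\<lambda>x. c * f x, \<lambda>x. c * g x) \<in> T)"

definition densely_defined :: "'a set \<Rightarrow> ('a \<Rightarrow> real) \<Rightarrow> 'a operator \<Rightarrow> bool" where
  "densely_defined V m T \<longleftrightarrow>
     (\<forall>h\<in>ell2 V m. \<forall>\<epsilon>>0. \<exists>f\<in>Domain T. ell2_norm V m (\<lambda>x. h x - f x) < \<epsilon>)"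

text \<open>
  For densely defined \<open>T\<close> this relation is the graph of the Hilbert space adjoint:
  \<open>u\<close> is in its domain iff \<open>\<langle>T f, u\<rangle> = \<langle>f, v\<rangle>\<close> on the domain of \<open>T\<close> for some \<open>v\<close>,
  which is then the unique image of \<open>u\<close>.
\<close>

definition adjoint_operator :: "'a set \<Rightarrow> ('a \<Rightarrow> real) \<Rightarrow> 'a operator \<Rightarrow> 'a operator" where
  "adjoint_operator V m T =
     {(u, v). u \<in> ell2 V m \<and> v \<in> ell2 V m \<and>
        (\<forall>(f, g)\<in>T. ell2_inner V m g u = ell2_inner V m f v)}"

definition self_adjoint :: "'a set \<Rightarrow> ('a \<Rightarrow> real) \<Rightarrow> 'a operator \<Rightarrow> bool" where
  "self_adjoint V m T \<longleftrightarrow>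
     linear_operator V m T \<and> densely_defined V m T \<and> adjoint_operator V m T = T"

definition essentially_self_adjoint :: "'a set \<Rightarrow> ('a \<Rightarrow> real) \<Rightarrow> 'a operator \<Rightarrow> bool" where
  "essentially_self_adjoint V m T \<longleftrightarrow> (\<exists>!S. self_adjoint V m S \<and> T \<subseteq> S)"

text \<open>
  In the following, \<open>b\<close> and \<open>m\<close> are only evaluated on the vertex set \<open>V\<close>, so passing a
  subset of the vertex set yields the objects of the induced subgraph.
  \<open>formal_laplacian V b m f\<close> is meaningful for \<open>f\<close> with \<open>\<Sum>y\<in>V. b x y * \<bar>f y\<bar> < \<infinity>\<close> for all
  \<open>x \<in> V\<close>, in particular for finitely supported \<open>f\<close>.
\<close>

definition formal_laplacian ::
  "'a set \<Rightarrow> ('a \<Rightarrow> 'a \<Rightarrow> real) \<Rightarrow> ('a \<Rightarrow> real) \<Rightarrow> ('a \<Rightarrow> real) \<Rightarrow> 'a \<Rightarrow> real" where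
  "formal_laplacian V b m f =
     (\<lambda>x. if x \<in> V then 1 / m x * (\<Sum>\<^sub>\<infinity>y\<in>V. b x y * (f x - f y)) else 0)"

definition finitely_supported :: "'a set \<Rightarrow> ('a \<Rightarrow> real) set" where
  "finitely_supported V = {f. (\<forall>x. x \<notin> V \<longrightarrow> f x = 0) \<and> finite {x. f x \<noteq> 0}}"

definition minimal_laplacian ::
  "'a set \<Rightarrow> ('a \<Rightarrow> 'a \<Rightarrow> real) \<Rightarrow> ('a \<Rightarrow> real) \<Rightarrow> 'a operator" where
  "minimal_laplacian V b m = {(f, formal_laplacian V b m f) | f. f \<in> finitely_supported V}"

definition vertex_boundary :: "'a set \<Rightarrow> ('a \<Rightarrow> 'a \<Rightarrow> real) \<Rightarrow> 'a set \<Rightarrow> 'a set" where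
  "vertex_boundary X b K = {x \<in> K. \<exists>y\<in>X - K. b x y > 0}"

definition boundary_weight ::
  "'a set \<Rightarrow> 'a set \<Rightarrow> ('a \<Rightarrow> 'a \<Rightarrow> real) \<Rightarrow> 'a \<Rightarrow> 'a \<Rightarrow> real" where
  "boundary_weight X1 X2 b x y =
     (if (x \<in> X1 \<and> y \<in> X2) \<or> (x \<in> X2 \<and> y \<in> X1) then b x y else 0)"

definition boundary_degree ::
  "'a set \<Rightarrow> 'a set \<Rightarrow> 'a set \<Rightarrow> ('a \<Rightarrow> 'a \<Rightarrow> real) \<Rightarrow> ('a \<Rightarrow> real) \<Rightarrow> 'a \<Rightarrow> real" where
  "boundary_degree X1 X2 X3 b m x =
     1 / m x * (\<Sum>\<^sub>\<infinity>y\<in>X3. boundary_weight X1 X2 b x y)"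

end

theory Submission imports Defs
begin

text \<open>
  On a real Hilbert space a symmetric operator \<open>T\<close> stays symmetric when a single pair of its
  adjoint is adjoined, so by Zorn's lemma every pair of \<open>T\<^sup>*\<close> lies in a self-adjoint extension of
  \<open>T\<close>. Hence \<open>T\<close> has a unique self-adjoint extension iff \<open>T\<^sup>*\<close> is symmetric.
  The Laplacian of \<open>X\<close> is the direct sum of the
  Laplacians of \<open>X\<^sub>1\<close> and \<open>X\<^sub>2\<close> plus the Laplacian \<open>B\<close> of the edges between them, and bounded
  boundary degree makes \<open>B\<close> an everywhere defined symmetric operator. So the adjoint for \<open>X\<close> is
  the direct sum of the two other adjoints plus \<open>B\<close>, and it is symmetric iff both of them are.
\<close>

text \<open>A self-adjoint extension on \<open>X\<close> need not respect the splitting into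
  \<open>X1\<close> and \<open>X2\<close>, but the adjoint does up to \<open>B\<close>: it is
  determined by testing against finitely supported functions, and each of these is the sum of its
  restrictions to the two parts. This is why essential self-adjointness is translated into symmetry
  of the adjoint. Two facts about \<open>B\<close> are used: it maps \<open>ell2\<close> into
  itself, by Cauchy-Schwarz against cut weights whose total mass at \<open>x\<close> is at most a
  constant times \<open>m x\<close>; and it can be moved across the inner product, by antisymmetry
  of a summable double series. Summability of the squares \<open>(b x y)\<^sup>2 / m y\<close> has
  another role: it puts the Laplacian of a point mass into \<open>ell2\<close>, so that the three
  minimal Laplacians are operators there.\<close>

definition restrict_to :: "'a set \<Rightarrow> ('a \<Rightarrow> real) \<Rightarrow> 'a \<Rightarrow> real" where
  "restrict_to Y f = (\<lambda>x. if x \<in> Y then f x else 0)"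

lemma restrict_to_apply: "restrict_to Y f x = (if x \<in> Y then f x else 0)"
  by (simp add: restrict_to_def)

text \<open>Inclusion in the adjoint also forces \<open>T\<close> to lie in
  \<open>ell2 V m \<times> ell2 V m\<close>, and it combines directly with the fact that the adjoint
  reverses inclusions.\<close>

definition symmetric_operator :: "'a set \<Rightarrow> ('a \<Rightarrow> real) \<Rightarrow> 'a operator \<Rightarrow> bool" where
  "symmetric_operator V m T \<longleftrightarrow> T \<subseteq> adjoint_operator V m T"

lemma has_sum_diff:
  fixes f g :: "'a \<Rightarrow> 'b :: real_normed_vector"
  assumes "(f has_sum a) A" "(g has_sum b) A"
  shows "((\<lambda>x. f x - g x) has_sum (a - b)) A"
  using has_sum_add[OF assms(1), of "\<lambda>x. - g x" "- b"] assms(2) by (simp add: has_sum_uminus)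

lemma summable_on_diff:
  fixes f g :: "'a \<Rightarrow> 'b :: real_normed_vector"
  assumes "f summable_on A" "g summable_on A"
  shows "(\<lambda>x. f x - g x) summable_on A"
  using assms has_sum_diff unfolding summable_on_def by blast

lemma infsum_diff:
  fixes f g :: "'a \<Rightarrow> 'b :: real_normed_vector"
  assumes "f summable_on A" "g summable_on A"
  shows "infsum (\<lambda>x. f x - g x) A = infsum f A - infsum g A"
  using assms by (intro infsumI has_sum_diff has_sum_infsum)

lemma ell2_inner_commute: "ell2_inner V m f g = ell2_inner V m g f"
  by (simp add: ell2_inner_def mult.commute)

lemma adjoint_antimono: "S \<subseteq> T \<Longrightarrow> adjoint_operator V m T \<subseteq> adjoint_operator V m S"
  by (auto simp: adjoint_operator_def)

lemma adjoint_operatorD: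
  assumes "(u, v) \<in> adjoint_operator V m T"
  shows "u \<in> ell2 V m" "v \<in> ell2 V m"
    and "\<And>f g. (f, g) \<in> T \<Longrightarrow> ell2_inner V m g u = ell2_inner V m f v"
  using assms by (auto simp: adjoint_operator_def)

lemma adjoint_operatorI:
  assumes "u \<in> ell2 V m" "v \<in> ell2 V m"
    and "\<And>f g. (f, g) \<in> T \<Longrightarrow> ell2_inner V m g u = ell2_inner V m f v"
  shows "(u, v) \<in> adjoint_operator V m T"
  using assms by (auto simp: adjoint_operator_def)

lemma symmetric_operatorD:
  assumes "symmetric_operator V m T" "(f, g) \<in> T"
  shows "f \<in> ell2 V m" "g \<in> ell2 V m"
    and "\<And>u v. (u, v) \<in> T \<Longrightarrow> ell2_inner V m g u = ell2_inner V m f v"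
  using assms adjoint_operatorD[of f g V m T] adjoint_operatorD(3)[of _ _ V m T f g]
  by (auto simp: symmetric_operator_def)

lemma symmetric_operatorI:
  assumes "T \<subseteq> ell2 V m \<times> ell2 V m"
    and "\<And>f g u v. (f, g) \<in> T \<Longrightarrow> (u, v) \<in> T \<Longrightarrow> ell2_inner V m g u = ell2_inner V m f v"
  shows "symmetric_operator V m T"
  using assms by (auto simp: symmetric_operator_def adjoint_operator_def)

section \<open>The Hilbert space of square summable functions\<close>

locale positive_weight =
  fixes V :: "'a set" and m :: "'a \<Rightarrow> real"
  assumes weight_pos: "\<And>x. x \<in> V \<Longrightarrow> m x > 0"
begin

lemma ell2_outside: "f \<in> ell2 V m \<Longrightarrow> x \<notin> V \<Longrightarrow> f x = 0"
  by (auto simp: ell2_def)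

lemma ell2_inner_summable:
  assumes "f \<in> ell2 V m" "g \<in> ell2 V m"
  shows "(\<lambda>x. f x * g x * m x) summable_on V"
proof -
  have "(\<lambda>x. (f x)\<^sup>2 * m x + (g x)\<^sup>2 * m x) summable_on V"
    using assms by (intro summable_on_add) (auto simp: ell2_def)
  then have "(\<lambda>x. norm (f x * g x * m x)) summable_on V"
  proof (rule summable_on_comparison_test)
    fix x assume "x \<in> V"
    \<comment> \<open>Adding the product turns the cross term of the square from minus two products
      into minus one, which is a crude form of the arithmetic-geometric mean inequality.\<close>
    have "0 \<le> (\<bar>f x\<bar> - \<bar>g x\<bar>)\<^sup>2 + \<bar>f x\<bar> * \<bar>g x\<bar>" "0 \<le> \<bar>f x\<bar> * \<bar>g x\<bar>"
      by auto
    then have "\<bar>f x\<bar> * \<bar>g x\<bar> \<le> (f x)\<^sup>2 + (g x)\<^sup>2"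
      by (simp add: power2_diff)
    then have "\<bar>f x\<bar> * \<bar>g x\<bar> * m x \<le> ((f x)\<^sup>2 + (g x)\<^sup>2) * m x"
      using weight_pos[OF \<open>x \<in> V\<close>] by (intro mult_right_mono) auto
    then show "norm (f x * g x * m x) \<le> (f x)\<^sup>2 * m x + (g x)\<^sup>2 * m x"
      using weight_pos[OF \<open>x \<in> V\<close>] by (simp add: abs_mult distrib_right)
  qed auto
  then show ?thesis
    by (rule abs_summable_summable)
qed

lemma ell2_zero: "(\<lambda>x. 0) \<in> ell2 V m"
  by (simp add: ell2_def)

lemma ell2_scale: "f \<in> ell2 V m \<Longrightarrow> (\<lambda>x. c * f x) \<in> ell2 V m"
  using summable_on_cmult_right[of "\<lambda>x. (f x)\<^sup>2 * m x" V "c\<^sup>2"]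
  by (auto simp: ell2_def power_mult_distrib mult.assoc)

lemma ell2_add:
  assumes "f \<in> ell2 V m" "g \<in> ell2 V m"
  shows "(\<lambda>x. f x + g x) \<in> ell2 V m"
proof -
  have "(\<lambda>x. (f x)\<^sup>2 * m x + (g x)\<^sup>2 * m x + 2 * (f x * g x * m x)) summable_on V"
    using assms
    by (intro summable_on_add summable_on_cmult_right ell2_inner_summable) (auto simp: ell2_def)
  also have "(\<lambda>x. (f x)\<^sup>2 * m x + (g x)\<^sup>2 * m x + 2 * (f x * g x * m x)) = (\<lambda>x. (f x + g x)\<^sup>2 * m x)"
    by (auto simp: power2_eq_square algebra_simps)
  finally show ?thesis
    using assms by (auto simp: ell2_def)
qed

lemma ell2_diff:
  assumes "f \<in> ell2 V m" "g \<in> ell2 V m"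
  shows "(\<lambda>x. f x - g x) \<in> ell2 V m"
  using ell2_add[OF assms(1) ell2_scale[OF assms(2), of "-1"]] by simp

lemma ell2_sum:
  "(\<And>i. i \<in> I \<Longrightarrow> f i \<in> ell2 V m) \<Longrightarrow> (\<lambda>x. \<Sum>i\<in>I. f i x) \<in> ell2 V m"
  by (induction I rule: infinite_finite_induct) (auto intro: ell2_add ell2_zero)

lemma ell2_inner_add_left:
  assumes "f \<in> ell2 V m" "g \<in> ell2 V m" "h \<in> ell2 V m"
  shows "ell2_inner V m (\<lambda>x. f x + g x) h = ell2_inner V m f h + ell2_inner V m g h"
  using ell2_inner_summable[OF assms(1,3)] ell2_inner_summable[OF assms(2,3)]
  by (simp add: ell2_inner_def distrib_right infsum_add)

lemma ell2_inner_add_right: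
  assumes "f \<in> ell2 V m" "g \<in> ell2 V m" "h \<in> ell2 V m"
  shows "ell2_inner V m h (\<lambda>x. f x + g x) = ell2_inner V m h f + ell2_inner V m h g"
  using ell2_inner_add_left[OF assms] by (simp add: ell2_inner_commute)

lemma ell2_inner_scale_left:
  "ell2_inner V m (\<lambda>x. c * f x) h = c * ell2_inner V m f h"
  unfolding ell2_inner_def by (subst infsum_cmult_right'[symmetric]) (simp add: mult.assoc)

lemma ell2_inner_scale_right:
  "ell2_inner V m h (\<lambda>x. c * f x) = c * ell2_inner V m h f"
  using ell2_inner_scale_left[of c f h] by (simp add: ell2_inner_commute)

lemmas ell2_inner_linear =
  ell2_inner_add_left ell2_inner_add_right ell2_inner_scale_left ell2_inner_scale_right

lemma ell2_inner_diff_right: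
  assumes "f \<in> ell2 V m" "g \<in> ell2 V m" "h \<in> ell2 V m"
  shows "ell2_inner V m h (\<lambda>x. f x - g x) = ell2_inner V m h f - ell2_inner V m h g"
  using ell2_inner_add_right[OF assms(1) ell2_scale[OF assms(2), of "-1"] assms(3)]
        ell2_inner_scale_right[of h "-1" g] by simp

lemma finitely_supported_ell2: "finitely_supported V \<subseteq> ell2 V m"
proof
  fix f assume f: "f \<in> finitely_supported V"
  have "(\<lambda>x. (f x)\<^sup>2 * m x) summable_on {x. f x \<noteq> 0}"
    using f by (simp add: finitely_supported_def)
  then have "(\<lambda>x. (f x)\<^sup>2 * m x) summable_on V"
    by (rule summable_on_cong_neutral[THEN iffD1, rotated -1])
       (use f in \<open>auto simp: finitely_supported_def\<close>)
  with f show "f \<in> ell2 V m"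
    by (auto simp: ell2_def finitely_supported_def)
qed

lemma ell2_inner_finite:
  assumes "finite F" "F \<subseteq> V" "\<And>x. x \<notin> F \<Longrightarrow> f x = 0"
  shows "ell2_inner V m f h = (\<Sum>x\<in>F. f x * h x * m x)"
proof -
  have "ell2_inner V m f h = (\<Sum>\<^sub>\<infinity>x\<in>F. f x * h x * m x)"
    unfolding ell2_inner_def by (rule infsum_cong_neutral) (use assms in auto)
  with assms show ?thesis by simp
qed

text \<open>Point masses already separate functions: pairing with the one at \<open>x\<close>
  returns the value at \<open>x\<close> times \<open>m x\<close>.\<close>

lemma ell2_eqI:
  assumes "u \<in> ell2 V m" "v \<in> ell2 V m"
    and "\<And>f. f \<in> finitely_supported V \<Longrightarrow> ell2_inner V m f u = ell2_inner V m f v"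
  shows "u = v"
proof
  fix x
  show "u x = v x"
  proof (cases "x \<in> V")
    case True
    let ?d = "\<lambda>y. if y = x then 1 else 0 :: real"
    have "?d \<in> finitely_supported V"
      using True by (auto simp: finitely_supported_def)
    then have "ell2_inner V m ?d u = ell2_inner V m ?d v"
      by (rule assms(3))
    moreover have "ell2_inner V m ?d h = h x * m x" for h
      using True by (subst ell2_inner_finite[of "{x}"]) auto
    ultimately have "u x * m x = v x * m x"
      by simp
    with weight_pos[OF True] show ?thesis by simp
  qed (use assms in \<open>simp add: ell2_outside\<close>)
qed

text \<open>Cutting \<open>h\<close> down to a large finite set leaves a tail of its norm series as
  squared error.\<close>

lemma densely_definedI:
  assumes "finitely_supported V \<subseteq> Domain T"
  shows "densely_defined V m T"
  unfolding densely_defined_def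
proof (intro ballI allI impI)
  fix h :: "'a \<Rightarrow> real" and e :: real
  assume h: "h \<in> ell2 V m" and e: "e > 0"
  let ?q = "\<lambda>x. (h x)\<^sup>2 * m x"
  have summ: "?q summable_on V" using h by (simp add: ell2_def)
  \<comment> \<open>The tolerance is \<open>e\<^sup>2\<close> because the norm is the square root of
    the tail.\<close>
  obtain F where F: "finite F" "F \<subseteq> V" "dist (sum ?q F) (infsum ?q V) < e\<^sup>2"
  proof -
    have "(sum ?q \<longlongrightarrow> infsum ?q V) (finite_subsets_at_top V)"
      using summ by (rule infsum_tendsto)
    then have "\<forall>\<^sub>F F in finite_subsets_at_top V. dist (sum ?q F) (infsum ?q V) < e\<^sup>2"
      using e by (intro tendstoD) auto
    with that show ?thesis
      by (auto simp: eventually_finite_subsets_at_top)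
  qed
  define f where "f = restrict_to F h"
  have "f \<in> finitely_supported V"
    using F finite_subset[of "{x. f x \<noteq> 0}" F]
    by (auto simp: finitely_supported_def f_def restrict_to_def)
  moreover have "ell2_inner V m (\<lambda>x. h x - f x) (\<lambda>x. h x - f x) < e\<^sup>2"
  proof -
    have "ell2_inner V m (\<lambda>x. h x - f x) (\<lambda>x. h x - f x) = infsum ?q (V - F)"
      unfolding ell2_inner_def
      by (rule infsum_cong_neutral) (auto simp: f_def restrict_to_def power2_eq_square)
    also have "\<dots> = infsum ?q V - sum ?q F"
      using infsum_Diff[OF summ _ F(2)] F(1) by simp
    finally show ?thesis using F(3) by (simp add: dist_real_def)
  qed
  then have "ell2_norm V m (\<lambda>x. h x - f x) < e"
    using e real_sqrt_less_mono unfolding ell2_norm_def by fastforce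
  ultimately show "\<exists>f\<in>Domain T. ell2_norm V m (\<lambda>x. h x - f x) < e"
    using assms by blast
qed

section \<open>Adjoints and self-adjoint extensions\<close>

lemma adjoint_single_valued:
  assumes "finitely_supported V \<subseteq> Domain T"
  shows "single_valued (adjoint_operator V m T)"
proof (rule single_valuedI)
  fix u v w assume uv: "(u, v) \<in> adjoint_operator V m T" "(u, w) \<in> adjoint_operator V m T"
  show "v = w"
  proof (rule ell2_eqI)
    fix f assume "f \<in> finitely_supported V"
    with assms obtain g where "(f, g) \<in> T" by blast
    with uv show "ell2_inner V m f v = ell2_inner V m f w"
      by (metis adjoint_operatorD(3))
  qed (use uv in \<open>auto dest: adjoint_operatorD\<close>)
qed

lemma linear_adjoint:
  assumes "T \<subseteq> ell2 V m \<times> ell2 V m" "finitely_supported V \<subseteq> Domain T"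
  shows "linear_operator V m (adjoint_operator V m T)"
  unfolding linear_operator_def
proof (intro conjI allI impI)
  show "single_valued (adjoint_operator V m T)"
    using assms by (intro adjoint_single_valued)
  show "adjoint_operator V m T \<subseteq> ell2 V m \<times> ell2 V m"
    by (auto simp: adjoint_operator_def)
  show "(\<lambda>x. 0, \<lambda>x. 0) \<in> adjoint_operator V m T"
    by (rule adjoint_operatorI) (auto intro: ell2_zero simp: ell2_inner_def)
next
  fix f g f' g' assume "(f, g) \<in> adjoint_operator V m T" "(f', g') \<in> adjoint_operator V m T"
  note D = adjoint_operatorD[OF this(1)] adjoint_operatorD[OF this(2)]
  show "(\<lambda>x. f x + f' x, \<lambda>x. g x + g' x) \<in> adjoint_operator V m T"
    using D assms(1) by (intro adjoint_operatorI ell2_add) (auto simp: ell2_inner_add_right subset_iff)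
next
  fix c f g assume "(f, g) \<in> adjoint_operator V m T"
  note D = adjoint_operatorD[OF this]
  show "(\<lambda>x. c * f x, \<lambda>x. c * g x) \<in> adjoint_operator V m T"
    using D by (intro adjoint_operatorI ell2_scale) (auto simp: ell2_inner_scale_right)
qed

text \<open>The new diagonal condition \<open>\<langle>w, v\<rangle> = \<langle>v, w\<rangle>\<close> is automatic over the reals;
  over the complex numbers this fails.\<close>

lemma symmetric_extension_by_adjoint_element:
  assumes lin: "linear_operator V m T" and dense: "finitely_supported V \<subseteq> Domain T"
    and sym: "symmetric_operator V m T" and vw: "(v, w) \<in> adjoint_operator V m T"
  obtains S where "linear_operator V m S" "symmetric_operator V m S" "T \<subseteq> S" "(v, w) \<in> S"
proof
  define S where "S = {(\<lambda>x. f x + c * v x, \<lambda>x. g x + c * w x) | f g c. (f, g) \<in> T}"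
  have T: "(\<lambda>x. 0, \<lambda>x. 0) \<in> T"
    "\<And>f g f' g'. (f, g) \<in> T \<Longrightarrow> (f', g') \<in> T \<Longrightarrow> (\<lambda>x. f x + f' x, \<lambda>x. g x + g' x) \<in> T"
    "\<And>c f g. (f, g) \<in> T \<Longrightarrow> (\<lambda>x. c * f x, \<lambda>x. c * g x) \<in> T"
    using lin by (auto simp: linear_operator_def)
  have SI: "(p, q) \<in> S"
    if "(f, g) \<in> T" "p = (\<lambda>x. f x + c * v x)" "q = (\<lambda>x. g x + c * w x)" for f g c p q
    using that by (auto simp: S_def)
  show TS: "T \<subseteq> S"
  proof (rule subrelI)
    fix f g assume "(f, g) \<in> T"
    then show "(f, g) \<in> S" by (rule SI[where c = 0]) auto
  qed
  show "(v, w) \<in> S"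
    using T(1) by (rule SI[where c = 1]) auto
  note D = adjoint_operatorD[OF vw]
  have Tl: "f \<in> ell2 V m" "g \<in> ell2 V m" if "(f, g) \<in> T" for f g
    using that sym by (auto dest: symmetric_operatorD)
  have sub: "S \<subseteq> ell2 V m \<times> ell2 V m"
    unfolding S_def using D(1,2) by (auto intro!: ell2_add ell2_scale dest: Tl)
  show symS: "symmetric_operator V m S"
  proof (rule symmetric_operatorI[OF sub])
    fix p q p' q' assume "(p, q) \<in> S" "(p', q') \<in> S"
    then obtain f g c f' g' c' where
      e: "p = (\<lambda>x. f x + c * v x)" "q = (\<lambda>x. g x + c * w x)" "(f, g) \<in> T"
         "p' = (\<lambda>x. f' x + c' * v x)" "q' = (\<lambda>x. g' x + c' * w x)" "(f', g') \<in> T"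
      unfolding S_def by blast
    note l = Tl[OF e(3)] Tl[OF e(6)] D(1,2)
    have "ell2_inner V m g f' = ell2_inner V m f g'"
      using sym e(3,6) by (rule symmetric_operatorD)
    moreover have "ell2_inner V m g v = ell2_inner V m f w"
      using e(3) by (rule D)
    moreover have "ell2_inner V m w f' = ell2_inner V m v g'"
      using D(3)[OF e(6)] by (simp add: ell2_inner_commute)
    ultimately show "ell2_inner V m q p' = ell2_inner V m p q'"
      unfolding e using l ell2_inner_commute[of V m w v]
      by (simp add: ell2_inner_linear ell2_add ell2_scale)
  qed
  show "linear_operator V m S"
    unfolding linear_operator_def
  proof (intro conjI allI impI)
    \<comment> \<open>Single-valuedness costs no computation: a symmetric \<open>S\<close> above
      \<open>T\<close> lies in the adjoint of \<open>S\<close>, hence in the adjoint of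
      \<open>T\<close>, which is single-valued because the domain of \<open>T\<close> is
      dense.\<close>
    have "S \<subseteq> adjoint_operator V m T"
      using symS adjoint_antimono[OF TS] by (auto simp: symmetric_operator_def)
    then show "single_valued S"
      by (rule single_valued_subset[OF _ adjoint_single_valued[OF dense]])
    show "(\<lambda>x. 0, \<lambda>x. 0) \<in> S" using T TS by auto
  next
    fix p q p' q' assume "(p, q) \<in> S" "(p', q') \<in> S"
    then obtain f g c f' g' c' where
      e: "p = (\<lambda>x. f x + c * v x)" "q = (\<lambda>x. g x + c * w x)" "(f, g) \<in> T"
         "p' = (\<lambda>x. f' x + c' * v x)" "q' = (\<lambda>x. g' x + c' * w x)" "(f', g') \<in> T"
      unfolding S_def by blast
    from T(2)[OF e(3,6)] show "(\<lambda>x. p x + p' x, \<lambda>x. q x + q' x) \<in> S"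
      by (rule SI[where c = "c + c'"]) (auto simp: e algebra_simps)
  next
    fix k p q assume "(p, q) \<in> S"
    then obtain f g c where
      e: "p = (\<lambda>x. f x + c * v x)" "q = (\<lambda>x. g x + c * w x)" "(f, g) \<in> T"
      unfolding S_def by blast
    from T(3)[OF e(3)] show "(\<lambda>x. k * p x, \<lambda>x. k * q x) \<in> S"
      by (rule SI[where c = "k * c"]) (auto simp: e algebra_simps)
  qed (rule sub)
qed

text \<open>A maximal symmetric extension contains its own adjoint, since any further pair of the
  adjoint could be adjoined. Over the complex numbers unequal deficiency indices would obstruct
  this.\<close>

lemma self_adjoint_extension_exists:
  assumes lin: "linear_operator V m T" and dense: "finitely_supported V \<subseteq> Domain T"
    and sym: "symmetric_operator V m T"
  obtains S where "self_adjoint V m S" "T \<subseteq> S"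
proof -
  define \<A> where "\<A> = {S. linear_operator V m S \<and> symmetric_operator V m S \<and> T \<subseteq> S}"
  have "\<exists>M\<in>\<A>. \<forall>S\<in>\<A>. M \<subseteq> S \<longrightarrow> S = M"
  proof (rule subset_Zorn_nonempty)
    show "\<A> \<noteq> {}" using assms by (auto simp: \<A>_def)
  next
    fix C assume C: "C \<noteq> {}" "subset.chain \<A> C"
    then have mem: "\<And>S. S \<in> C \<Longrightarrow> linear_operator V m S \<and> symmetric_operator V m S \<and> T \<subseteq> S"
      by (auto simp: subset.chain_def \<A>_def)
    \<comment> \<open>Symmetry and additivity involve only two pairs at a time, and in a chain two
      pairs always share a member.\<close>
    have common: "\<exists>S\<in>C. p \<in> S \<and> q \<in> S" if "p \<in> \<Union>C" "q \<in> \<Union>C" for p q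
      using that C(2) unfolding subset.chain_def by blast
    have TC: "T \<subseteq> \<Union>C" using C(1) mem by blast
    have sub: "\<Union>C \<subseteq> ell2 V m \<times> ell2 V m"
      using mem unfolding linear_operator_def by blast
    have symC: "symmetric_operator V m (\<Union>C)"
      using sub
    proof (rule symmetric_operatorI)
      fix f g u v assume "(f, g) \<in> \<Union>C" "(u, v) \<in> \<Union>C"
      then obtain S where "S \<in> C" "(f, g) \<in> S" "(u, v) \<in> S" using common by blast
      with mem show "ell2_inner V m g u = ell2_inner V m f v"
        by (blast intro: symmetric_operatorD)
    qed
    have "linear_operator V m (\<Union>C)"
      unfolding linear_operator_def
    proof (intro conjI allI impI)
      have "\<Union>C \<subseteq> adjoint_operator V m T"
        using symC adjoint_antimono[OF TC] unfolding symmetric_operator_def by blast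
      then show "single_valued (\<Union>C)"
        by (rule single_valued_subset[OF _ adjoint_single_valued[OF dense]])
      show "(\<lambda>x. 0, \<lambda>x. 0) \<in> \<Union>C" using lin TC by (auto simp: linear_operator_def)
    next
      fix f g f' g' assume "(f, g) \<in> \<Union>C" "(f', g') \<in> \<Union>C"
      then obtain S where "S \<in> C" "(f, g) \<in> S" "(f', g') \<in> S" using common by blast
      with mem[of S] show "(\<lambda>x. f x + f' x, \<lambda>x. g x + g' x) \<in> \<Union>C"
        unfolding linear_operator_def by blast
    next
      fix c f g assume "(f, g) \<in> \<Union>C"
      then obtain S where "S \<in> C" "(f, g) \<in> S" by blast
      with mem[of S] show "(\<lambda>x. c * f x, \<lambda>x. c * g x) \<in> \<Union>C"
        unfolding linear_operator_def by blast
    qed (rule sub)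
    with symC TC show "\<Union>C \<in> \<A>" by (simp add: \<A>_def)
  qed
  then obtain M where M: "linear_operator V m M" "symmetric_operator V m M" "T \<subseteq> M"
    and max: "\<And>S. linear_operator V m S \<Longrightarrow> symmetric_operator V m S \<Longrightarrow> M \<subseteq> S \<Longrightarrow> S = M"
    unfolding \<A>_def by auto
  have denseM: "finitely_supported V \<subseteq> Domain M"
    using dense M(3) by (meson Domain_mono subset_trans)
  have "adjoint_operator V m M \<subseteq> M"
  proof (rule subrelI)
    fix v w assume "(v, w) \<in> adjoint_operator V m M"
    then obtain S where "linear_operator V m S" "symmetric_operator V m S" "M \<subseteq> S" "(v, w) \<in> S"
      using symmetric_extension_by_adjoint_element[OF M(1) denseM M(2)] by blast
    with max show "(v, w) \<in> M" by blast
  qed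
  with M(1,2) densely_definedI[OF denseM] have "self_adjoint V m M"
    by (auto simp: self_adjoint_def symmetric_operator_def)
  with M(3) that show thesis by blast
qed

text \<open>If all pairs of the adjoint lie in one self-adjoint \<open>S\<close>, then the adjoint
  is symmetric as a part of \<open>S\<close>. Conversely, a symmetric adjoint equals its own
  adjoint, because \<open>T\<close> lies inside it and adjoints reverse inclusions; it is then the
  extension sought.\<close>

theorem essentially_self_adjoint_iff_symmetric_adjoint:
  assumes lin: "linear_operator V m T" and dense: "finitely_supported V \<subseteq> Domain T"
    and sym: "symmetric_operator V m T"
  shows "essentially_self_adjoint V m T \<longleftrightarrow> symmetric_operator V m (adjoint_operator V m T)"
proof
  assume "essentially_self_adjoint V m T"
  then obtain S where S: "self_adjoint V m S" "T \<subseteq> S"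
    and unique: "\<And>S'. self_adjoint V m S' \<Longrightarrow> T \<subseteq> S' \<Longrightarrow> S' = S"
    unfolding essentially_self_adjoint_def by blast
  \<comment> \<open>The self-adjoint extension built around \<open>(v, w)\<close> may depend on that
    pair; uniqueness identifies all of them with \<open>S\<close>.\<close>
  have AS: "adjoint_operator V m T \<subseteq> S"
  proof (rule subrelI)
    fix v w assume "(v, w) \<in> adjoint_operator V m T"
    then obtain S0 where S0: "linear_operator V m S0" "symmetric_operator V m S0" "T \<subseteq> S0" "(v, w) \<in> S0"
      using symmetric_extension_by_adjoint_element[OF assms] by blast
    have "finitely_supported V \<subseteq> Domain S0"
      using dense S0(3) by (meson Domain_mono subset_trans)
    then obtain S' where "self_adjoint V m S'" "S0 \<subseteq> S'"
      using self_adjoint_extension_exists S0 by blast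
    with unique[of S'] S0 show "(v, w) \<in> S" by blast
  qed
  then have "adjoint_operator V m S \<subseteq> adjoint_operator V m (adjoint_operator V m T)"
    by (rule adjoint_antimono)
  with AS S(1) show "symmetric_operator V m (adjoint_operator V m T)"
    by (auto simp: self_adjoint_def symmetric_operator_def)
next
  let ?A = "adjoint_operator V m T"
  assume A: "symmetric_operator V m ?A"
  have TA: "T \<subseteq> ?A" using sym by (simp add: symmetric_operator_def)
  then have eq: "adjoint_operator V m ?A = ?A"
    using A adjoint_antimono[OF TA] unfolding symmetric_operator_def by blast
  have "T \<subseteq> ell2 V m \<times> ell2 V m" using lin by (simp add: linear_operator_def)
  then have "linear_operator V m ?A" using dense by (rule linear_adjoint)
  moreover have "densely_defined V m ?A"
    using dense TA by (intro densely_definedI) (meson Domain_mono subset_trans)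
  ultimately have "self_adjoint V m ?A" using eq by (simp add: self_adjoint_def)
  \<comment> \<open>Self-adjoint operators admit no proper self-adjoint extension: taking adjoints
    in \<open>S \<subseteq> ?A\<close> gives the reverse inclusion.\<close>
  moreover have "S = ?A" if S: "self_adjoint V m S" "T \<subseteq> S" for S
  proof
    have SS: "adjoint_operator V m S = S" using S(1) by (simp add: self_adjoint_def)
    then show SA: "S \<subseteq> ?A" using adjoint_antimono[OF S(2), of V m] by simp
    show "?A \<subseteq> S" using adjoint_antimono[OF SA, of V m] eq SS by simp
  qed
  ultimately show "essentially_self_adjoint V m T"
    using TA unfolding essentially_self_adjoint_def by blast
qed

end

section \<open>Laplacians on finitely supported functions\<close>

lemma finitely_supported_outside: "f \<in> finitely_supported V \<Longrightarrow> x \<notin> V \<Longrightarrow> f x = 0"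
  by (auto simp: finitely_supported_def)

lemma finitely_supported_mono: "Y \<subseteq> V \<Longrightarrow> finitely_supported Y \<subseteq> finitely_supported V"
  by (auto simp: finitely_supported_def)

lemma finitely_supported_restrict:
  assumes "f \<in> finitely_supported V" "Y \<subseteq> V"
  shows "restrict_to Y f \<in> finitely_supported Y"
proof -
  have "{x. restrict_to Y f x \<noteq> 0} \<subseteq> {x. f x \<noteq> 0}"
    by (auto simp: restrict_to_def)
  with assms(1) have "finite {x. restrict_to Y f x \<noteq> 0}"
    by (auto simp: finitely_supported_def intro: finite_subset)
  then show ?thesis by (auto simp: finitely_supported_def restrict_to_def)
qed

lemma finitely_supported_common_support:
  assumes "f \<in> finitely_supported V" "g \<in> finitely_supported V"
  obtains F where "finite F" "F \<subseteq> V" "\<And>x. x \<notin> F \<Longrightarrow> f x = 0" "\<And>x. x \<notin> F \<Longrightarrow> g x = 0"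
proof
  show "finite ({x. f x \<noteq> 0} \<union> {x. g x \<noteq> 0})" "{x. f x \<noteq> 0} \<union> {x. g x \<noteq> 0} \<subseteq> V"
    using assms by (auto simp: finitely_supported_def)
qed auto

lemma finitely_supportedI:
  assumes "finite F" "F \<subseteq> V" "\<And>x. x \<notin> F \<Longrightarrow> f x = 0"
  shows "f \<in> finitely_supported V"
proof -
  have "{x. f x \<noteq> 0} \<subseteq> F" using assms(3) by blast
  then have "finite {x. f x \<noteq> 0}" using assms(1) by (rule finite_subset)
  with assms show ?thesis by (auto simp: finitely_supported_def)
qed

lemma Domain_minimal_laplacian [simp]:
  "Domain (minimal_laplacian V b m) = finitely_supported V"
  by (auto simp: minimal_laplacian_def)

lemma minimal_laplacianI:
  "f \<in> finitely_supported V \<Longrightarrow> (f, formal_laplacian V b m f) \<in> minimal_laplacian V b m"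
  by (auto simp: minimal_laplacian_def)

lemma formal_laplacian_outside: "x \<notin> V \<Longrightarrow> formal_laplacian V b m f x = 0"
  by (simp add: formal_laplacian_def)

text \<open>These conditions pass to every subset of the vertex set, finite or not, so that
  \<open>X\<close>, \<open>X1\<close> and \<open>X2\<close> are all instances.\<close>

locale square_summable_graph = positive_weight V m
  for V :: "'a set" and m :: "'a \<Rightarrow> real" +
  fixes b :: "'a \<Rightarrow> 'a \<Rightarrow> real"
  assumes edge_sym: "\<And>x y. x \<in> V \<Longrightarrow> y \<in> V \<Longrightarrow> b x y = b y x"
    and edge_summable: "\<And>x. x \<in> V \<Longrightarrow> b x summable_on V"
    and edge_square_summable: "\<And>x. x \<in> V \<Longrightarrow> (\<lambda>y. (b x y)\<^sup>2 / m y) summable_on V"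
begin

lemma square_summable_subgraph:
  assumes "Y \<subseteq> V"
  shows "square_summable_graph Y m b"
proof
  fix x assume "x \<in> Y"
  with assms have "x \<in> V" by auto
  from summable_on_subset_banach[OF edge_summable[OF this] assms]
    summable_on_subset_banach[OF edge_square_summable[OF this] assms]
  show "b x summable_on Y" "(\<lambda>y. (b x y)\<^sup>2 / m y) summable_on Y" by auto
qed (use assms weight_pos in \<open>auto intro: edge_sym\<close>)

lemma finite_support_edge_summable:
  assumes f: "f \<in> finitely_supported V" and x: "x \<in> V"
  shows "(\<lambda>y. b x y * (f x - f y)) summable_on V"
proof -
  have "(\<lambda>y. b x y * f y) summable_on {y. f y \<noteq> 0}"
    using f by (simp add: finitely_supported_def)
  then have "(\<lambda>y. b x y * f y) summable_on V"
    by (rule summable_on_cong_neutral[THEN iffD1, rotated -1])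
       (use f in \<open>auto simp: finitely_supported_def\<close>)
  moreover have "(\<lambda>y. b x y * f x) summable_on V"
    using edge_summable[OF x] by (rule summable_on_cmult_left)
  ultimately have "(\<lambda>y. b x y * f x - b x y * f y) summable_on V"
    by (intro summable_on_diff)
  then show ?thesis by (simp add: right_diff_distrib)
qed

text \<open>Degree minus adjacency: the series becomes a diagonal term and a finite sum, from which
  additivity, membership in \<open>ell2\<close> and symmetry can be read off.\<close>

lemma formal_laplacian_finite_support:
  assumes F: "finite F" "F \<subseteq> V" "\<And>x. x \<notin> F \<Longrightarrow> f x = 0" and x: "x \<in> V"
  shows "formal_laplacian V b m f x = (infsum (b x) V * f x - (\<Sum>z\<in>F. b x z * f z)) / m x"
proof -
  have eq: "(\<Sum>\<^sub>\<infinity>y\<in>V. b x y * f y) = (\<Sum>\<^sub>\<infinity>y\<in>F. b x y * f y)"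
    by (rule infsum_cong_neutral) (use F in auto)
  have "(\<lambda>y. b x y * f y) summable_on F" using F by simp
  then have summ: "(\<lambda>y. b x y * f y) summable_on V"
    by (rule summable_on_cong_neutral[THEN iffD1, rotated -1]) (use F in auto)
  have "(\<Sum>\<^sub>\<infinity>y\<in>V. b x y * (f x - f y)) = (\<Sum>\<^sub>\<infinity>y\<in>V. b x y * f x) - (\<Sum>\<^sub>\<infinity>y\<in>V. b x y * f y)"
    unfolding right_diff_distrib
    by (rule infsum_diff[OF summable_on_cmult_left[OF edge_summable[OF x]] summ])
  also have "(\<Sum>\<^sub>\<infinity>y\<in>V. b x y * f x) = infsum (b x) V * f x"
    by (rule infsum_cmult_left')
  finally show ?thesis
    using x F(1) by (simp add: formal_laplacian_def eq)
qed

text \<open>Up to sign and the value at \<open>z\<close>, this is the Laplacian of the point mass at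
  \<open>z\<close>. Its squared norm is the sum of \<open>(b z x)\<^sup>2 / m x\<close> over
  \<open>x\<close>, finite by \<open>edge_square_summable\<close>.\<close>

lemma edge_ell2:
  assumes z: "z \<in> V"
  shows "(\<lambda>x. if x \<in> V then b x z / m x else 0) \<in> ell2 V m"
proof -
  have "(\<lambda>x. (if x \<in> V then b x z / m x else 0)\<^sup>2 * m x) summable_on V \<longleftrightarrow>
        (\<lambda>x. (b z x)\<^sup>2 / m x) summable_on V"
    using weight_pos z edge_sym
    by (intro summable_on_cong) (auto simp: power2_eq_square field_simps)
  with edge_square_summable[OF z] show ?thesis by (simp add: ell2_def)
qed

text \<open>The diagonal part is finitely supported, and the rest is a finite combination of the
  columns from \<open>edge_ell2\<close>.\<close>

lemma formal_laplacian_ell2: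
  assumes f: "f \<in> finitely_supported V"
  shows "formal_laplacian V b m f \<in> ell2 V m"
proof -
  obtain F where F: "finite F" "F \<subseteq> V" "\<And>x. x \<notin> F \<Longrightarrow> f x = 0"
    using finitely_supported_common_support[OF f f] by metis
  let ?d = "\<lambda>x. infsum (b x) V * f x / m x"
  let ?e = "\<lambda>z x. f z * (if x \<in> V then b x z / m x else 0)"
  have "formal_laplacian V b m f = (\<lambda>x. ?d x - (\<Sum>z\<in>F. ?e z x))"
  proof
    fix x show "formal_laplacian V b m f x = ?d x - (\<Sum>z\<in>F. ?e z x)"
    proof (cases "x \<in> V")
      case True
      then show ?thesis
        using formal_laplacian_finite_support[OF F True]
        by (simp add: diff_divide_distrib sum_divide_distrib mult.commute)
    qed (use F f in \<open>auto simp: formal_laplacian_outside finitely_supported_outside\<close>)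
  qed
  moreover have "?d \<in> ell2 V m"
    using finitely_supported_ell2 F by (auto intro!: finitely_supportedI[OF F(1,2)])
  moreover have "(\<lambda>x. \<Sum>z\<in>F. ?e z x) \<in> ell2 V m"
    using F(2) by (intro ell2_sum ell2_scale edge_ell2) auto
  ultimately show ?thesis by (simp add: ell2_diff)
qed

lemma linear_minimal_laplacian: "linear_operator V m (minimal_laplacian V b m)"
  unfolding linear_operator_def
proof (intro conjI allI impI)
  show "minimal_laplacian V b m \<subseteq> ell2 V m \<times> ell2 V m"
    using finitely_supported_ell2 formal_laplacian_ell2 by (auto simp: minimal_laplacian_def)
  show "single_valued (minimal_laplacian V b m)"
    by (auto simp: minimal_laplacian_def single_valued_def)
  have "(\<lambda>x. 0) \<in> finitely_supported V" by (simp add: finitely_supported_def)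
  from minimal_laplacianI[OF this]
  show "(\<lambda>x. 0, \<lambda>x. 0) \<in> minimal_laplacian V b m"
    by (simp add: formal_laplacian_def cong: if_cong)
next
  fix f g f' g' assume "(f, g) \<in> minimal_laplacian V b m" "(f', g') \<in> minimal_laplacian V b m"
  then have f: "f \<in> finitely_supported V" "f' \<in> finitely_supported V"
    and g: "g = formal_laplacian V b m f" "g' = formal_laplacian V b m f'"
    by (auto simp: minimal_laplacian_def)
  \<comment> \<open>One support set for both functions lets the finite sums be added term by
    term.\<close>
  obtain F where F: "finite F" "F \<subseteq> V" "\<And>x. x \<notin> F \<Longrightarrow> f x = 0" "\<And>x. x \<notin> F \<Longrightarrow> f' x = 0"
    using finitely_supported_common_support[OF f] by metis
  have "formal_laplacian V b m (\<lambda>x. f x + f' x) = (\<lambda>x. g x + g' x)"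
  proof
    fix x show "formal_laplacian V b m (\<lambda>x. f x + f' x) x = g x + g' x"
    proof (cases "x \<in> V")
      case True
      have "formal_laplacian V b m (\<lambda>x. f x + f' x) x =
          (infsum (b x) V * (f x + f' x) - (\<Sum>z\<in>F. b x z * (f z + f' z))) / m x"
        using F True by (intro formal_laplacian_finite_support) auto
      moreover have "g x = (infsum (b x) V * f x - (\<Sum>z\<in>F. b x z * f z)) / m x"
        unfolding g using F True by (intro formal_laplacian_finite_support) auto
      moreover have "g' x = (infsum (b x) V * f' x - (\<Sum>z\<in>F. b x z * f' z)) / m x"
        unfolding g using F True by (intro formal_laplacian_finite_support) auto
      ultimately show ?thesis
        by (simp add: distrib_left sum.distrib add_divide_distrib diff_divide_distrib)
    qed (simp add: g formal_laplacian_outside)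
  qed
  moreover have "(\<lambda>x. f x + f' x) \<in> finitely_supported V"
    using F by (intro finitely_supportedI[of F]) auto
  ultimately show "(\<lambda>x. f x + f' x, \<lambda>x. g x + g' x) \<in> minimal_laplacian V b m"
    by (auto simp: minimal_laplacian_def)
next
  fix c f g assume "(f, g) \<in> minimal_laplacian V b m"
  then have f: "f \<in> finitely_supported V" and g: "g = formal_laplacian V b m f"
    by (auto simp: minimal_laplacian_def)
  have "formal_laplacian V b m (\<lambda>x. c * f x) = (\<lambda>x. c * g x)"
  proof
    fix x
    have "(\<Sum>\<^sub>\<infinity>y\<in>V. b x y * (c * f x - c * f y)) = (\<Sum>\<^sub>\<infinity>y\<in>V. c * (b x y * (f x - f y)))"
      by (simp add: algebra_simps)
    also have "\<dots> = c * (\<Sum>\<^sub>\<infinity>y\<in>V. b x y * (f x - f y))"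
      by (rule infsum_cmult_right')
    finally show "formal_laplacian V b m (\<lambda>x. c * f x) x = c * g x"
      by (simp add: g formal_laplacian_def)
  qed
  moreover have "(\<lambda>x. c * f x) \<in> finitely_supported V"
    using f finite_subset[of "{x. c * f x \<noteq> 0}" "{x. f x \<noteq> 0}"]
    by (auto simp: finitely_supported_def)
  ultimately show "(\<lambda>x. c * f x, \<lambda>x. c * g x) \<in> minimal_laplacian V b m"
    by (auto simp: minimal_laplacian_def)
qed

text \<open>On a common finite support the factor \<open>m x\<close> cancels, and the pairing is the
  bilinear form of a finite symmetric matrix, with degrees on the diagonal minus the entries of
  \<open>b\<close>.\<close>

lemma symmetric_minimal_laplacian: "symmetric_operator V m (minimal_laplacian V b m)"
proof (rule symmetric_operatorI)
  show "minimal_laplacian V b m \<subseteq> ell2 V m \<times> ell2 V m"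
    using linear_minimal_laplacian by (simp add: linear_operator_def)
  fix f g u v assume "(f, g) \<in> minimal_laplacian V b m" "(u, v) \<in> minimal_laplacian V b m"
  then have fu: "f \<in> finitely_supported V" "u \<in> finitely_supported V"
    and gv: "g = formal_laplacian V b m f" "v = formal_laplacian V b m u"
    by (auto simp: minimal_laplacian_def)
  obtain F where F: "finite F" "F \<subseteq> V" "\<And>x. x \<notin> F \<Longrightarrow> f x = 0" "\<And>x. x \<notin> F \<Longrightarrow> u x = 0"
    using finitely_supported_common_support[OF fu] by metis
  have inner: "ell2_inner V m p (formal_laplacian V b m q) =
      (\<Sum>x\<in>F. infsum (b x) V * p x * q x) - (\<Sum>x\<in>F. \<Sum>z\<in>F. b x z * p x * q z)"
    if "\<And>x. x \<notin> F \<Longrightarrow> p x = 0" "\<And>x. x \<notin> F \<Longrightarrow> q x = 0" for p q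
  proof -
    have "ell2_inner V m p (formal_laplacian V b m q) =
        (\<Sum>x\<in>F. p x * formal_laplacian V b m q x * m x)"
      using F(1,2) that(1) by (rule ell2_inner_finite)
    also have "\<dots> = (\<Sum>x\<in>F. infsum (b x) V * p x * q x - (\<Sum>z\<in>F. b x z * p x * q z))"
    proof (rule sum.cong)
      fix x assume "x \<in> F"
      then have x: "x \<in> V" using F by auto
      have "p x * formal_laplacian V b m q x * m x =
          p x * (infsum (b x) V * q x - (\<Sum>z\<in>F. b x z * q z))"
        using weight_pos[OF x] formal_laplacian_finite_support[OF F(1,2) that(2) x] by simp
      then show "p x * formal_laplacian V b m q x * m x =
          infsum (b x) V * p x * q x - (\<Sum>z\<in>F. b x z * p x * q z)"
        by (simp add: right_diff_distrib sum_distrib_left mult_ac)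
    qed simp
    finally show ?thesis by (simp add: sum_subtractf)
  qed
  have "(\<Sum>x\<in>F. \<Sum>z\<in>F. b x z * u x * f z) = (\<Sum>x\<in>F. \<Sum>z\<in>F. b x z * f x * u z)"
    by (subst sum.swap) (use F edge_sym in \<open>auto intro!: sum.cong simp: subset_iff\<close>)
  then show "ell2_inner V m g u = ell2_inner V m f v"
    using F by (subst ell2_inner_commute) (simp add: gv inner mult_ac)
qed

lemma essentially_self_adjoint_minimal_laplacian_iff:
  "essentially_self_adjoint V m (minimal_laplacian V b m) \<longleftrightarrow>
   symmetric_operator V m (adjoint_operator V m (minimal_laplacian V b m))"
  by (rule essentially_self_adjoint_iff_symmetric_adjoint
      [OF linear_minimal_laplacian _ symmetric_minimal_laplacian]) simp

end

section \<open>Laplacians of bounded degree on the whole Hilbert space\<close>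

text \<open>An abstract version of the graph of cut edges. \<open>C\<close> bounds the degree
  relative to \<open>m\<close>; it is positive so that one may divide by
  \<open>C * m x\<close>.\<close>

locale bounded_degree_graph = positive_weight V m
  for V :: "'a set" and m :: "'a \<Rightarrow> real" +
  fixes w :: "'a \<Rightarrow> 'a \<Rightarrow> real" and C :: real
  assumes w_nonneg: "\<And>x y. x \<in> V \<Longrightarrow> y \<in> V \<Longrightarrow> w x y \<ge> 0"
    and w_sym: "\<And>x y. x \<in> V \<Longrightarrow> y \<in> V \<Longrightarrow> w x y = w y x"
    and w_summable: "\<And>x. x \<in> V \<Longrightarrow> w x summable_on V"
    and w_degree: "\<And>x. x \<in> V \<Longrightarrow> infsum (w x) V \<le> C * m x"
    and C_pos: "C > 0"
begin

text \<open>Summing over \<open>y\<close> leaves at most \<open>C * ((f x)\<^sup>2 * m x)\<close>,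
  and for nonnegative terms summable row sums suffice.\<close>

lemma weighted_square_summable:
  assumes f: "f \<in> ell2 V m"
  shows "(\<lambda>(x, y). w x y * (f x)\<^sup>2) summable_on V \<times> V"
proof (rule summable_on_SigmaI)
  fix x assume x: "x \<in> V"
  show "((\<lambda>y. case (x, y) of (x, y) \<Rightarrow> w x y * (f x)\<^sup>2) has_sum infsum (w x) V * (f x)\<^sup>2) V"
    using has_sum_cmult_left[OF has_sum_infsum[OF w_summable[OF x]], of "(f x)\<^sup>2"] by simp
next
  have "(\<lambda>x. C * ((f x)\<^sup>2 * m x)) summable_on V"
    using f by (intro summable_on_cmult_right) (simp add: ell2_def)
  then show "(\<lambda>x. infsum (w x) V * (f x)\<^sup>2) summable_on V"
  proof (rule summable_on_comparison_test)
    fix x assume x: "x \<in> V"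
    show "infsum (w x) V * (f x)\<^sup>2 \<le> C * ((f x)\<^sup>2 * m x)"
      using mult_right_mono[OF w_degree[OF x], of "(f x)\<^sup>2"] by (simp add: mult_ac)
    show "0 \<le> infsum (w x) V * (f x)\<^sup>2"
      using w_nonneg x by (intro mult_nonneg_nonneg infsum_nonneg) auto
  qed
qed (use w_nonneg in auto)

text \<open>Finite energy of \<open>f\<close>: the squared difference is at most twice the sum of
  the squares, and symmetry of \<open>w\<close> reduces the square at \<open>y\<close> to the one at
  \<open>x\<close>.\<close>

lemma weighted_difference_square_summable:
  assumes f: "f \<in> ell2 V m"
  shows "(\<lambda>(x, y). w x y * (f x - f y)\<^sup>2) summable_on V \<times> V"
proof -
  note s1 = weighted_square_summable[OF f]
  have "(\<lambda>(x, y). w y x * (f y)\<^sup>2) summable_on V \<times> V"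
    using s1 summable_on_swap[of "\<lambda>(x, y). w x y * (f x)\<^sup>2" V V] by simp
  then have s2: "(\<lambda>(x, y). w x y * (f y)\<^sup>2) summable_on V \<times> V"
    by (rule summable_on_cong[THEN iffD1, rotated]) (auto simp: w_sym)
  have "(\<lambda>p. 2 * ((\<lambda>(x, y). w x y * (f x)\<^sup>2) p + (\<lambda>(x, y). w x y * (f y)\<^sup>2) p)) summable_on V \<times> V"
    by (intro summable_on_cmult_right summable_on_add s1 s2)
  then show ?thesis
  proof (rule summable_on_comparison_test)
    fix p assume "p \<in> V \<times> V"
    then obtain x y where p: "p = (x, y)" "x \<in> V" "y \<in> V" by auto
    have "0 \<le> (f x + f y)\<^sup>2" by simp
    then have "(f x - f y)\<^sup>2 \<le> 2 * ((f x)\<^sup>2 + (f y)\<^sup>2)"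
      by (simp add: power2_eq_square algebra_simps)
    from mult_left_mono[OF this w_nonneg[OF p(2,3)]]
    show "(case p of (x, y) \<Rightarrow> w x y * (f x - f y)\<^sup>2) \<le>
        2 * ((\<lambda>(x, y). w x y * (f x)\<^sup>2) p + (\<lambda>(x, y). w x y * (f y)\<^sup>2) p)"
      by (simp add: p algebra_simps)
  qed (auto simp: w_nonneg)
qed

lemma weighted_difference_summable:
  assumes f: "f \<in> ell2 V m" and x: "x \<in> V"
  shows "(\<lambda>y. w x y * (f x - f y)\<^sup>2) summable_on V"
    and "(\<lambda>y. w x y * (f x - f y)) summable_on V"
proof -
  show s: "(\<lambda>y. w x y * (f x - f y)\<^sup>2) summable_on V"
    using weighted_difference_square_summable[OF f] x by (rule summable_on_SigmaD1)
  have "(\<lambda>y. w x y + w x y * (f x - f y)\<^sup>2) summable_on V"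
    by (intro summable_on_add s w_summable x)
  then have "(\<lambda>y. norm (w x y * (f x - f y))) summable_on V"
  proof (rule summable_on_comparison_test)
    fix y assume y: "y \<in> V"
    \<comment> \<open>This yields a bound by one plus the square; the constant one is summable
      against \<open>w x\<close> because the degree is finite.\<close>
    have "0 \<le> (\<bar>f x - f y\<bar> - 1)\<^sup>2 + \<bar>f x - f y\<bar>" by simp
    then have "\<bar>f x - f y\<bar> \<le> 1 + (f x - f y)\<^sup>2"
      by (simp add: power2_diff)
    from mult_left_mono[OF this w_nonneg[OF x y]] w_nonneg[OF x y]
    show "norm (w x y * (f x - f y)) \<le> w x y + w x y * (f x - f y)\<^sup>2"
      by (simp add: abs_mult distrib_left)
  qed auto
  then show "(\<lambda>y. w x y * (f x - f y)) summable_on V"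
    by (rule abs_summable_summable)
qed

text \<open>Cauchy-Schwarz for the measure \<open>w x\<close>, of total mass at most
  \<open>C * m x\<close>, obtained by expanding a nonnegative quadratic in a shift
  \<open>t\<close>.\<close>

lemma weighted_difference_Cauchy_Schwarz:
  assumes f: "f \<in> ell2 V m" and x: "x \<in> V"
  shows "(\<Sum>\<^sub>\<infinity>y\<in>V. w x y * (f x - f y))\<^sup>2 \<le> C * m x * (\<Sum>\<^sub>\<infinity>y\<in>V. w x y * (f x - f y)\<^sup>2)"
proof -
  define D where "D = C * m x"
  define s where "s = (\<Sum>\<^sub>\<infinity>y\<in>V. w x y * (f x - f y))"
  define q where "q = (\<Sum>\<^sub>\<infinity>y\<in>V. w x y * (f x - f y)\<^sup>2)"
  \<comment> \<open>This value minimizes the upper bound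
    \<open>q - 2 * t * s + t\<^sup>2 * D\<close>.\<close>
  define t where "t = s / D"
  have D: "D > 0" using C_pos weight_pos[OF x] by (simp add: D_def)
  note summ = weighted_difference_summable[OF f x] w_summable[OF x]
  have "0 \<le> (\<Sum>\<^sub>\<infinity>y\<in>V. w x y * (f x - f y - t)\<^sup>2)"
    using w_nonneg x by (intro infsum_nonneg) auto
  also have "(\<lambda>y. w x y * (f x - f y - t)\<^sup>2) =
      (\<lambda>y. (w x y * (f x - f y)\<^sup>2 + (- 2 * t) * (w x y * (f x - f y))) + t\<^sup>2 * w x y)"
    by (auto simp: power2_eq_square algebra_simps)
  also have "(\<Sum>\<^sub>\<infinity>y\<in>V. (w x y * (f x - f y)\<^sup>2 + (- 2 * t) * (w x y * (f x - f y))) + t\<^sup>2 * w x y) =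
      q + (- 2 * t) * s + t\<^sup>2 * infsum (w x) V"
    unfolding q_def s_def infsum_cmult_right'[symmetric]
    using infsum_add[OF summable_on_add[OF summ(1) summable_on_cmult_right[OF summ(2), of "- 2 * t"]]
        summable_on_cmult_right[OF summ(3), of "t\<^sup>2"]]
      infsum_add[OF summ(1) summable_on_cmult_right[OF summ(2), of "- 2 * t"]]
    by (rule trans[OF _ arg_cong2[where f = "(+)", OF _ refl]])
  also have "\<dots> \<le> q + (- 2 * t) * s + t\<^sup>2 * D"
    using w_degree[OF x] by (simp add: D_def mult_left_mono)
  also have "\<dots> = q - s\<^sup>2 / D"
    using D by (simp add: t_def power2_eq_square field_simps)
  finally have "s\<^sup>2 \<le> D * q"
    using D by (simp add: field_simps)
  then show ?thesis by (simp add: D_def s_def q_def)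
qed

text \<open>Dividing Cauchy-Schwarz by \<open>m x\<close> leaves \<open>C\<close> times the energy
  at \<open>x\<close>, which is summable over \<open>x\<close>.\<close>

lemma formal_laplacian_bounded_ell2:
  assumes f: "f \<in> ell2 V m"
  shows "formal_laplacian V w m f \<in> ell2 V m"
proof -
  have "(\<lambda>x. \<Sum>\<^sub>\<infinity>y\<in>V. w x y * (f x - f y)\<^sup>2) summable_on V"
    using summable_on_Sigma_banach[OF weighted_difference_square_summable[OF f]] by simp
  then have "(\<lambda>x. C * (\<Sum>\<^sub>\<infinity>y\<in>V. w x y * (f x - f y)\<^sup>2)) summable_on V"
    by (rule summable_on_cmult_right)
  then have "(\<lambda>x. (formal_laplacian V w m f x)\<^sup>2 * m x) summable_on V"
  proof (rule summable_on_comparison_test)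
    fix x assume x: "x \<in> V"
    note mx = weight_pos[OF x]
    have "(formal_laplacian V w m f x)\<^sup>2 * m x = (\<Sum>\<^sub>\<infinity>y\<in>V. w x y * (f x - f y))\<^sup>2 / m x"
      using x mx by (simp add: formal_laplacian_def power2_eq_square)
    also have "\<dots> \<le> C * (\<Sum>\<^sub>\<infinity>y\<in>V. w x y * (f x - f y)\<^sup>2)"
      using weighted_difference_Cauchy_Schwarz[OF f x] mx by (simp add: field_simps)
    finally show "(formal_laplacian V w m f x)\<^sup>2 * m x \<le> C * (\<Sum>\<^sub>\<infinity>y\<in>V. w x y * (f x - f y)\<^sup>2)" .
  qed (use weight_pos in \<open>auto simp: less_imp_le\<close>)
  then show ?thesis
    by (simp add: ell2_def formal_laplacian_def)
qed

text \<open>Joint summability over pairs of vertices is what permits exchanging the two sums in the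
  proof of symmetry.\<close>

lemma bounded_energy_summable:
  assumes f: "f \<in> ell2 V m" and g: "g \<in> ell2 V m"
  shows "(\<lambda>(x, y). w x y * (f x - f y) * g x) summable_on V \<times> V"
proof -
  have "(\<lambda>p. (\<lambda>(x, y). w x y * (f x - f y)\<^sup>2) p + (\<lambda>(x, y). w x y * (g x)\<^sup>2) p) summable_on V \<times> V"
    by (intro summable_on_add weighted_difference_square_summable weighted_square_summable f g)
  then have "(\<lambda>p. norm ((\<lambda>(x, y). w x y * (f x - f y) * g x) p)) summable_on V \<times> V"
  proof (rule summable_on_comparison_test)
    fix p assume "p \<in> V \<times> V"
    then obtain x y where p: "p = (x, y)" "x \<in> V" "y \<in> V" by auto
    have "0 \<le> (\<bar>f x - f y\<bar> - \<bar>g x\<bar>)\<^sup>2 + \<bar>f x - f y\<bar> * \<bar>g x\<bar>" "0 \<le> \<bar>f x - f y\<bar> * \<bar>g x\<bar>"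
      by auto
    then have "\<bar>f x - f y\<bar> * \<bar>g x\<bar> \<le> (f x - f y)\<^sup>2 + (g x)\<^sup>2"
      unfolding power2_diff[of "\<bar>f x - f y\<bar>"] power2_abs by linarith
    from mult_left_mono[OF this w_nonneg[OF p(2,3)]]
    show "norm ((\<lambda>(x, y). w x y * (f x - f y) * g x) p) \<le>
        (\<lambda>(x, y). w x y * (f x - f y)\<^sup>2) p + (\<lambda>(x, y). w x y * (g x)\<^sup>2) p"
      using w_nonneg[OF p(2,3)] by (simp add: p abs_mult distrib_left mult.assoc)
  qed auto
  then show ?thesis by (rule abs_summable_summable)
qed

text \<open>The two sides are double sums whose difference has an antisymmetric summand, so
  exchanging the order of summation shows that this difference equals its own negative.\<close>

lemma formal_laplacian_bounded_symmetric:
  assumes f: "f \<in> ell2 V m" and g: "g \<in> ell2 V m"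
  shows "ell2_inner V m (formal_laplacian V w m f) g = ell2_inner V m f (formal_laplacian V w m g)"
proof -
  let ?e = "\<lambda>f g x y. w x y * (f x - f y) * g x"
  \<comment> \<open>The terms in \<open>f x * g x\<close> cancel, leaving
    \<open>w x y * (f x * g y - f y * g x)\<close>.\<close>
  let ?a = "\<lambda>x y. ?e f g x y - ?e g f x y"
  have inner: "ell2_inner V m (formal_laplacian V w m u) v = infsum (\<lambda>(x, y). ?e u v x y) (V \<times> V)"
    if "u \<in> ell2 V m" "v \<in> ell2 V m" for u v
  proof -
    have "ell2_inner V m (formal_laplacian V w m u) v = (\<Sum>\<^sub>\<infinity>x\<in>V. \<Sum>\<^sub>\<infinity>y\<in>V. ?e u v x y)"
      unfolding ell2_inner_def
    proof (rule infsum_cong)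
      fix x assume x: "x \<in> V"
      have "(\<Sum>\<^sub>\<infinity>y\<in>V. ?e u v x y) = (\<Sum>\<^sub>\<infinity>y\<in>V. w x y * (u x - u y)) * v x"
        by (rule infsum_cmult_left')
      then show "formal_laplacian V w m u x * v x * m x = (\<Sum>\<^sub>\<infinity>y\<in>V. ?e u v x y)"
        using weight_pos[OF x] x by (simp add: formal_laplacian_def)
    qed
    also have "\<dots> = infsum (\<lambda>(x, y). ?e u v x y) (V \<times> V)"
      using bounded_energy_summable[OF that] by (rule infsum_Sigma'_banach)
    finally show ?thesis .
  qed
  have fg: "(\<lambda>(x, y). ?e f g x y) summable_on V \<times> V" "(\<lambda>(x, y). ?e g f x y) summable_on V \<times> V"
    using f g by (simp_all add: bounded_energy_summable)
  have "(\<lambda>p. (\<lambda>(x, y). ?e f g x y) p - (\<lambda>(x, y). ?e g f x y) p) summable_on V \<times> V"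
    by (intro summable_on_diff fg)
  then have a: "(\<lambda>(x, y). ?a x y) summable_on V \<times> V"
    by (simp add: case_prod_unfold)
  have "infsum (\<lambda>(x, y). ?a x y) (V \<times> V) = (\<Sum>\<^sub>\<infinity>x\<in>V. \<Sum>\<^sub>\<infinity>y\<in>V. ?a x y)"
    using infsum_Sigma'_banach[OF a] by simp
  also have "\<dots> = (\<Sum>\<^sub>\<infinity>y\<in>V. \<Sum>\<^sub>\<infinity>x\<in>V. ?a x y)"
    using a by (rule infsum_swap_banach)
  also have "\<dots> = (\<Sum>\<^sub>\<infinity>y\<in>V. \<Sum>\<^sub>\<infinity>x\<in>V. - ?a y x)"
    using w_sym by (intro infsum_cong) (auto simp: algebra_simps)
  also have "\<dots> = - (\<Sum>\<^sub>\<infinity>y\<in>V. \<Sum>\<^sub>\<infinity>x\<in>V. ?a y x)"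
    by (simp only: infsum_uminus)
  also have "(\<Sum>\<^sub>\<infinity>y\<in>V. \<Sum>\<^sub>\<infinity>x\<in>V. ?a y x) = infsum (\<lambda>(x, y). ?a x y) (V \<times> V)"
    using infsum_Sigma'_banach[OF a] by simp
  finally have "infsum (\<lambda>(x, y). ?a x y) (V \<times> V) = 0" by simp
  moreover have "infsum (\<lambda>(x, y). ?a x y) (V \<times> V) =
      infsum (\<lambda>(x, y). ?e f g x y) (V \<times> V) - infsum (\<lambda>(x, y). ?e g f x y) (V \<times> V)"
    using infsum_diff[OF fg] by (simp add: case_prod_unfold)
  ultimately show ?thesis
    using inner[OF f g] inner[OF g f] by (simp add: ell2_inner_commute)
qed

end

section \<open>Restriction to a set of vertices and extension by zero\<close>

lemma ell2_restrict:
  assumes "f \<in> ell2 V m" "Y \<subseteq> V"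
  shows "restrict_to Y f \<in> ell2 Y m"
proof -
  have "(\<lambda>x. (f x)\<^sup>2 * m x) summable_on Y"
    using assms by (auto simp: ell2_def intro: summable_on_subset_banach)
  then have "(\<lambda>x. (restrict_to Y f x)\<^sup>2 * m x) summable_on Y"
    by (rule summable_on_cong[THEN iffD1, rotated]) (simp add: restrict_to_def)
  then show ?thesis by (simp add: ell2_def restrict_to_def)
qed

lemma ell2_mono:
  assumes "Y \<subseteq> V"
  shows "ell2 Y m \<subseteq> ell2 V m"
proof
  fix f assume f: "f \<in> ell2 Y m"
  then have "(\<lambda>x. (f x)\<^sup>2 * m x) summable_on Y" by (simp add: ell2_def)
  then have "(\<lambda>x. (f x)\<^sup>2 * m x) summable_on V"
    by (rule summable_on_cong_neutral[THEN iffD1, rotated -1]) (use assms f in \<open>auto simp: ell2_def\<close>)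
  with assms f show "f \<in> ell2 V m" by (auto simp: ell2_def)
qed

lemma ell2_inner_subset:
  assumes "Y \<subseteq> V" "\<And>x. x \<notin> Y \<Longrightarrow> f x = 0"
  shows "ell2_inner V m f g = ell2_inner Y m f g"
  unfolding ell2_inner_def by (rule infsum_cong_neutral) (use assms in auto)

lemma ell2_inner_restrict [simp]:
  "ell2_inner Y m (restrict_to Y f) g = ell2_inner Y m f g"
  "ell2_inner Y m f (restrict_to Y g) = ell2_inner Y m f g"
  by (simp_all add: ell2_inner_def restrict_to_apply cong: infsum_cong)

lemma (in positive_weight) ell2_inner_split:
  assumes "f \<in> ell2 V m" "g \<in> ell2 V m" "Y \<subseteq> V"
  shows "ell2_inner V m f g = ell2_inner Y m f g + ell2_inner (V - Y) m f g"
proof -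
  note summ = ell2_inner_summable[OF assms(1,2), THEN summable_on_subset_banach]
  have "infsum (\<lambda>x. f x * g x * m x) (Y \<union> (V - Y)) = ell2_inner Y m f g + ell2_inner (V - Y) m f g"
    unfolding ell2_inner_def using assms(3) by (intro infsum_Un_disjoint summ) auto
  moreover have "Y \<union> (V - Y) = V" using assms(3) by auto
  ultimately show ?thesis by (simp add: ell2_inner_def)
qed

section \<open>Adjoints of the Laplacian before and after the cut\<close>

text \<open>Only the rows of \<open>w\<close> in \<open>Y\<close> are prescribed; those entering
  \<open>Y\<close> from outside follow by symmetry. The same \<open>w\<close> can thus serve
  \<open>Y\<close> and its complement at once.\<close>

locale cut_graph = square_summable_graph V m b + bounded_degree_graph V m w C
  for V :: "'a set" and m :: "'a \<Rightarrow> real" and b w :: "'a \<Rightarrow> 'a \<Rightarrow> real" and C :: real +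
  fixes Y :: "'a set"
  assumes Y_subset: "Y \<subseteq> V"
    and cut_weight: "\<And>x y. x \<in> Y \<Longrightarrow> y \<in> V \<Longrightarrow> w x y = (if y \<in> Y then 0 else b x y)"
begin

lemma positive_weight_Y: "positive_weight Y m"
  by (rule positive_weight.intro) (use Y_subset weight_pos in blast)

lemma square_summable_Y: "square_summable_graph Y m b"
  using Y_subset by (rule square_summable_subgraph)

text \<open>Edges staying in \<open>Y\<close> give the Laplacian of the subgraph. Edges leaving
  \<open>Y\<close> are exactly those seen by \<open>w\<close>, which vanishes between vertices of
  \<open>Y\<close>.\<close>

lemma formal_laplacian_inside:
  assumes f: "f \<in> finitely_supported V" and x: "x \<in> Y"
  shows "formal_laplacian V b m f x =
    formal_laplacian Y b m (restrict_to Y f) x + formal_laplacian V w m f x"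
proof -
  have xV: "x \<in> V" using x Y_subset by auto
  note summ = finite_support_edge_summable[OF f xV, THEN summable_on_subset_banach]
  have "(\<Sum>\<^sub>\<infinity>y\<in>V. b x y * (f x - f y)) = (\<Sum>\<^sub>\<infinity>y\<in>Y \<union> (V - Y). b x y * (f x - f y))"
    using Y_subset by (simp add: Un_absorb1)
  also have "\<dots> = (\<Sum>\<^sub>\<infinity>y\<in>Y. b x y * (f x - f y)) + (\<Sum>\<^sub>\<infinity>y\<in>V - Y. b x y * (f x - f y))"
    using Y_subset by (intro infsum_Un_disjoint summ) auto
  also have "(\<Sum>\<^sub>\<infinity>y\<in>Y. b x y * (f x - f y)) =
      (\<Sum>\<^sub>\<infinity>y\<in>Y. b x y * (restrict_to Y f x - restrict_to Y f y))"
    using x by (intro infsum_cong) (simp add: restrict_to_def)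
  also have "(\<Sum>\<^sub>\<infinity>y\<in>V - Y. b x y * (f x - f y)) = (\<Sum>\<^sub>\<infinity>y\<in>V. w x y * (f x - f y))"
    using x cut_weight by (intro infsum_cong_neutral) auto
  finally show ?thesis
    using x xV by (simp add: formal_laplacian_def distrib_left)
qed

text \<open>Outside \<open>Y\<close> the function \<open>f\<close> is zero, so only edges into
  \<open>Y\<close> contribute, and on those \<open>w\<close> agrees with \<open>b\<close>.\<close>

lemma formal_laplacian_outside_support:
  assumes f: "f \<in> finitely_supported Y" and x: "x \<in> V - Y"
  shows "formal_laplacian V b m f x = formal_laplacian V w m f x"
proof -
  have "b x y * (f x - f y) = w x y * (f x - f y)" if y: "y \<in> V" for y
  proof (cases "y \<in> Y")
    case True
    then show ?thesis
      using x y cut_weight[of y x] w_sym[of x y] edge_sym[of x y] by simp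
  qed (use x f in \<open>simp add: finitely_supported_outside\<close>)
  then have "(\<Sum>\<^sub>\<infinity>y\<in>V. b x y * (f x - f y)) = (\<Sum>\<^sub>\<infinity>y\<in>V. w x y * (f x - f y))"
    by (rule infsum_cong)
  then show ?thesis
    by (simp add: formal_laplacian_def)
qed

lemma formal_laplacian_subgraph:
  assumes f: "f \<in> finitely_supported Y"
  shows "formal_laplacian V b m f = (\<lambda>x. formal_laplacian Y b m f x + formal_laplacian V w m f x)"
proof
  fix x
  have fV: "f \<in> finitely_supported V" using f finitely_supported_mono[OF Y_subset] by auto
  have "restrict_to Y f = f"
    using f by (auto simp: restrict_to_def finitely_supported_outside)
  then show "formal_laplacian V b m f x = formal_laplacian Y b m f x + formal_laplacian V w m f x"
    using formal_laplacian_inside[OF fV, of x] formal_laplacian_outside_support[OF f, of x] Y_subset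
    by (cases "x \<in> Y"; cases "x \<in> V") (auto simp: formal_laplacian_outside)
qed

text \<open>On test functions supported in \<open>Y\<close> the subgraph Laplacian is the full one
  minus that of \<open>w\<close>; the pair moves the former across, symmetry the latter. The
  Laplacian of \<open>w\<close> acts on all of \<open>u\<close> before the cut to \<open>Y\<close>,
  because it couples \<open>Y\<close> to its complement.\<close>

lemma adjoint_restrict:
  assumes uv: "(u, v) \<in> adjoint_operator V m (minimal_laplacian V b m)"
  shows "(restrict_to Y u, restrict_to Y (\<lambda>x. v x - formal_laplacian V w m u x))
    \<in> adjoint_operator Y m (minimal_laplacian Y b m)"
proof (rule adjoint_operatorI)
  note D = adjoint_operatorD[OF uv]
  have Bu: "formal_laplacian V w m u \<in> ell2 V m"
    using D(1) by (rule formal_laplacian_bounded_ell2)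
  show "restrict_to Y u \<in> ell2 Y m"
    "restrict_to Y (\<lambda>x. v x - formal_laplacian V w m u x) \<in> ell2 Y m"
    using D Bu Y_subset by (auto intro: ell2_restrict ell2_diff)
  fix f g assume "(f, g) \<in> minimal_laplacian Y b m"
  then have f: "f \<in> finitely_supported Y" and g: "g = formal_laplacian Y b m f"
    by (auto simp: minimal_laplacian_def)
  have fV: "f \<in> finitely_supported V" using f finitely_supported_mono[OF Y_subset] by auto
  then have f2: "f \<in> ell2 V m" using finitely_supported_ell2 by auto
  have g2: "g \<in> ell2 V m"
    using square_summable_graph.formal_laplacian_ell2[OF square_summable_Y f] ell2_mono[OF Y_subset]
    by (auto simp: g)
  have "ell2_inner Y m g u = ell2_inner V m g u"
    using Y_subset by (intro ell2_inner_subset[symmetric]) (auto simp: g formal_laplacian_outside)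
  also have "\<dots> = ell2_inner V m (formal_laplacian V b m f) u - ell2_inner V m (formal_laplacian V w m f) u"
    using ell2_inner_add_left[OF g2 formal_laplacian_bounded_ell2[OF f2] D(1)]
    by (simp add: formal_laplacian_subgraph[OF f] g)
  also have "\<dots> = ell2_inner V m f v - ell2_inner V m f (formal_laplacian V w m u)"
    using D(3)[OF minimal_laplacianI[OF fV]] formal_laplacian_bounded_symmetric[OF f2 D(1)] by simp
  also have "\<dots> = ell2_inner V m f (\<lambda>x. v x - formal_laplacian V w m u x)"
    using D(2) Bu f2 by (rule ell2_inner_diff_right[symmetric])
  also have "\<dots> = ell2_inner Y m f (\<lambda>x. v x - formal_laplacian V w m u x)"
    using Y_subset by (rule ell2_inner_subset) (use f in \<open>simp add: finitely_supported_outside\<close>)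
  finally show "ell2_inner Y m g (restrict_to Y u) =
      ell2_inner Y m f (restrict_to Y (\<lambda>x. v x - formal_laplacian V w m u x))"
    by simp
qed

text \<open>The zero extension of \<open>u\<close> may have a nonzero \<open>w\<close>-Laplacian
  outside \<open>Y\<close>, so the new image is corrected on all of \<open>V\<close>. In the pairing
  with \<open>u\<close> only values in \<open>Y\<close> count, where
  \<open>formal_laplacian_inside\<close> applies.\<close>

lemma adjoint_extend:
  assumes uv: "(u, v) \<in> adjoint_operator Y m (minimal_laplacian Y b m)"
  shows "(u, \<lambda>x. v x + formal_laplacian V w m u x) \<in> adjoint_operator V m (minimal_laplacian V b m)"
proof (rule adjoint_operatorI)
  interpret Y: positive_weight Y m by (rule positive_weight_Y)
  note D = adjoint_operatorD[OF uv]
  have u2: "u \<in> ell2 V m" and v2: "v \<in> ell2 V m" using D ell2_mono[OF Y_subset] by auto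
  have Bu: "formal_laplacian V w m u \<in> ell2 V m"
    using u2 by (rule formal_laplacian_bounded_ell2)
  show "u \<in> ell2 V m" "(\<lambda>x. v x + formal_laplacian V w m u x) \<in> ell2 V m"
    using u2 v2 Bu by (auto intro: ell2_add)
  fix f g assume "(f, g) \<in> minimal_laplacian V b m"
  then have f: "f \<in> finitely_supported V" and g: "g = formal_laplacian V b m f"
    by (auto simp: minimal_laplacian_def)
  have f2: "f \<in> ell2 V m" using f finitely_supported_ell2 by auto
  have fY: "restrict_to Y f \<in> finitely_supported Y"
    using f Y_subset by (rule finitely_supported_restrict)
  have LY: "formal_laplacian Y b m (restrict_to Y f) \<in> ell2 Y m"
    using square_summable_Y fY by (rule square_summable_graph.formal_laplacian_ell2)
  have BY: "restrict_to Y (formal_laplacian V w m f) \<in> ell2 Y m"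
    using formal_laplacian_bounded_ell2[OF f2] Y_subset by (rule ell2_restrict)
  have inner_u: "ell2_inner V m h u = ell2_inner Y m h u" for h
    using ell2_inner_subset[OF Y_subset, of u m h] Y.ell2_outside[OF D(1)]
    by (simp add: ell2_inner_commute)
  have inner_v: "ell2_inner V m h v = ell2_inner Y m h v" for h
    using ell2_inner_subset[OF Y_subset, of v m h] Y.ell2_outside[OF D(2)]
    by (simp add: ell2_inner_commute)
  have gY: "restrict_to Y g =
      (\<lambda>x. formal_laplacian Y b m (restrict_to Y f) x + restrict_to Y (formal_laplacian V w m f) x)"
  proof
    fix x show "restrict_to Y g x =
        formal_laplacian Y b m (restrict_to Y f) x + restrict_to Y (formal_laplacian V w m f) x"
      using formal_laplacian_inside[OF f, of x]
      by (cases "x \<in> Y") (simp_all add: restrict_to_apply g formal_laplacian_outside)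
  qed
  have "ell2_inner V m g u = ell2_inner Y m (restrict_to Y g) u"
    by (simp add: inner_u)
  also have "\<dots> = ell2_inner Y m (formal_laplacian Y b m (restrict_to Y f)) u
      + ell2_inner Y m (formal_laplacian V w m f) u"
    unfolding gY using Y.ell2_inner_add_left[OF LY BY D(1)] by simp
  also have "\<dots> = ell2_inner Y m f v + ell2_inner V m (formal_laplacian V w m f) u"
    using D(3)[OF minimal_laplacianI[OF fY]] by (simp add: inner_u)
  also have "\<dots> = ell2_inner V m f v + ell2_inner V m f (formal_laplacian V w m u)"
    using formal_laplacian_bounded_symmetric[OF f2 u2] by (simp add: inner_v)
  also have "\<dots> = ell2_inner V m f (\<lambda>x. v x + formal_laplacian V w m u x)"
    using v2 Bu f2 by (rule ell2_inner_add_right[symmetric])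
  finally show "ell2_inner V m g u = ell2_inner V m f (\<lambda>x. v x + formal_laplacian V w m u x)" .
qed

text \<open>After extension by zero, the two \<open>w\<close> terms cancel by symmetry of that
  Laplacian.\<close>

lemma symmetric_adjoint_subgraph:
  assumes sym: "symmetric_operator V m (adjoint_operator V m (minimal_laplacian V b m))"
  shows "symmetric_operator Y m (adjoint_operator Y m (minimal_laplacian Y b m))"
proof (rule symmetric_operatorI)
  interpret Y: positive_weight Y m by (rule positive_weight_Y)
  let ?A = "adjoint_operator Y m (minimal_laplacian Y b m)"
  show "?A \<subseteq> ell2 Y m \<times> ell2 Y m" by (auto simp: adjoint_operator_def)
  fix u v u' v' assume uv: "(u, v) \<in> ?A" and uv': "(u', v') \<in> ?A"
  note D = adjoint_operatorD(1,2)[OF uv] adjoint_operatorD(1,2)[OF uv']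
  have V: "u \<in> ell2 V m" "v \<in> ell2 V m" "u' \<in> ell2 V m" "v' \<in> ell2 V m"
    using D ell2_mono[OF Y_subset] by auto
  have "ell2_inner V m (\<lambda>x. v x + formal_laplacian V w m u x) u' =
      ell2_inner V m u (\<lambda>x. v' x + formal_laplacian V w m u' x)"
    using symmetric_operatorD(3)[OF sym adjoint_extend[OF uv] adjoint_extend[OF uv']] .
  then have "ell2_inner V m v u' = ell2_inner V m u v'"
    using formal_laplacian_bounded_symmetric[OF V(1,3)] V
    by (simp add: ell2_inner_linear formal_laplacian_bounded_ell2)
  then show "ell2_inner Y m v u' = ell2_inner Y m u v'"
    using Y.ell2_outside D Y_subset ell2_inner_subset[of Y V v m u'] ell2_inner_subset[of Y V u m v']
    by simp
qed

end

text \<open>With the \<open>w\<close> term subtracted, the inner products split over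
  \<open>Y\<close> and its complement, where symmetry is known; the \<open>w\<close> term is
  symmetric by itself.\<close>

lemma symmetric_adjoint_union:
  assumes "cut_graph V m b w C Y" "cut_graph V m b w C (V - Y)"
    and symY: "symmetric_operator Y m (adjoint_operator Y m (minimal_laplacian Y b m))"
    and symZ: "symmetric_operator (V - Y) m (adjoint_operator (V - Y) m (minimal_laplacian (V - Y) b m))"
  shows "symmetric_operator V m (adjoint_operator V m (minimal_laplacian V b m))"
proof (rule symmetric_operatorI)
  interpret Y: cut_graph V m b w C Y by fact
  interpret Z: cut_graph V m b w C "V - Y" by fact
  let ?A = "adjoint_operator V m (minimal_laplacian V b m)"
  let ?B = "formal_laplacian V w m"
  show "?A \<subseteq> ell2 V m \<times> ell2 V m" by (auto simp: adjoint_operator_def)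
  fix u v u' v' assume uv: "(u, v) \<in> ?A" and uv': "(u', v') \<in> ?A"
  note D = adjoint_operatorD(1,2)[OF uv] adjoint_operatorD(1,2)[OF uv']
  \<comment> \<open>A single correction works for both parts because both cuts use the same
    \<open>w\<close>.\<close>
  define p where "p = (\<lambda>x. v x - ?B u x)"
  define p' where "p' = (\<lambda>x. v' x - ?B u' x)"
  have B: "?B u \<in> ell2 V m" "?B u' \<in> ell2 V m" using D by (auto intro: Y.formal_laplacian_bounded_ell2)
  have p: "p \<in> ell2 V m" "p' \<in> ell2 V m" using D B by (auto simp: p_def p'_def intro: Y.ell2_diff)
  have "ell2_inner Y m p u' = ell2_inner Y m u p'"
    using symmetric_operatorD(3)[OF symY Y.adjoint_restrict[OF uv] Y.adjoint_restrict[OF uv']]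
    by (simp add: p_def p'_def)
  moreover have "ell2_inner (V - Y) m p u' = ell2_inner (V - Y) m u p'"
    using symmetric_operatorD(3)[OF symZ Z.adjoint_restrict[OF uv] Z.adjoint_restrict[OF uv']]
    by (simp add: p_def p'_def)
  ultimately have "ell2_inner V m p u' = ell2_inner V m u p'"
    using Y.ell2_inner_split[OF p(1) D(3) Y.Y_subset] Y.ell2_inner_split[OF D(1) p(2) Y.Y_subset]
    by simp
  moreover have "ell2_inner V m v u' = ell2_inner V m p u' + ell2_inner V m (?B u) u'"
    using Y.ell2_inner_add_left[OF p(1) B(1) D(3)] by (simp add: p_def)
  moreover have "ell2_inner V m u v' = ell2_inner V m u p' + ell2_inner V m u (?B u')"
    using Y.ell2_inner_add_right[OF p(2) B(2) D(1)] by (simp add: p'_def)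
  ultimately show "ell2_inner V m v u' = ell2_inner V m u v'"
    using Y.formal_laplacian_bounded_symmetric[OF D(1,3)] by simp
qed

section \<open>Boundary weights of a partition as weights of a cut\<close>

theorem theorem3p3:
  fixes X X1 X2 X3 :: "'a set" and b :: "'a \<Rightarrow> 'a \<Rightarrow> real" and m :: "'a \<Rightarrow> real"
  assumes "weighted_graph X b m"
    and "\<And>x. x \<in> X \<Longrightarrow> (\<lambda>y. (b x y)\<^sup>2 / m y) summable_on X"
    and "X1 \<subseteq> X"
    and "X2 = X - X1"
    and "X3 = vertex_boundary X b X1 \<union> vertex_boundary X b X2"
    and "bounded (boundary_degree X1 X2 X3 b m ` X3)"
  shows "essentially_self_adjoint X m (minimal_laplacian X b m) \<longleftrightarrow>
         essentially_self_adjoint X1 m (minimal_laplacian X1 b m) \<and>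
         essentially_self_adjoint X2 m (minimal_laplacian X2 b m)"
proof -
  interpret weighted_graph X b m by fact
  define w where "w = boundary_weight X1 X2 b"
  have w_eq: "w x y = (if (x \<in> X1) = (y \<in> X1) then 0 else b x y)" if "x \<in> X" "y \<in> X" for x y
    using that assms(4) by (auto simp: w_def boundary_weight_def)
  have X3_sub: "X3 \<subseteq> X"
    using assms(3-5) by (auto simp: vertex_boundary_def)
  \<comment> \<open>An edge of positive weight across the cut has both ends in \<open>X3\<close>, so
    summing over \<open>X\<close> or over \<open>X3\<close> gives the same degree.\<close>
  have w_X3: "x \<in> X3 \<and> y \<in> X3" if xy: "x \<in> X" "y \<in> X" "w x y \<noteq> 0" for x y
  proof -
    have "b x y > 0" "b y x > 0" "(x \<in> X1) \<noteq> (y \<in> X1)"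
      using xy w_eq[OF xy(1,2)] b_nonneg[OF xy(1,2)] b_sym[OF xy(1,2)] by (auto split: if_splits)
    then show ?thesis
      using xy assms(3-5) by (auto simp: vertex_boundary_def)
  qed
  obtain K where K: "\<And>x. x \<in> X3 \<Longrightarrow> \<bar>boundary_degree X1 X2 X3 b m x\<bar> \<le> K"
    using assms(6) by (auto simp: bounded_iff)
  \<comment> \<open>The absolute value and the added one keep \<open>C\<close> positive even when
    \<open>K\<close> is not, as can happen for empty \<open>X3\<close>.\<close>
  define C where "C = \<bar>K\<bar> + 1"
  have cut: "cut_graph X m b w C Y" if Y: "Y = X1 \<or> Y = X2" for Y
  proof
    fix x assume x: "x \<in> X"
    show "w x summable_on X"
      using b_summable[OF x]
      by (rule summable_on_comparison_test) (auto simp: w_eq x b_nonneg)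
    show "infsum (w x) X \<le> C * m x"
    proof (cases "x \<in> X3")
      case True
      have "infsum (w x) X = infsum (w x) X3"
      proof (rule infsum_cong_neutral)
        show "w x y = 0" if "y \<in> X - X3" for y
          using w_X3[OF x, of y] that by blast
        show "w x y = 0" if "y \<in> X3 - X" for y
          using X3_sub that by blast
      qed simp
      also have "\<dots> = boundary_degree X1 X2 X3 b m x * m x"
        using m_pos[OF x] by (simp add: boundary_degree_def w_def)
      also have "\<dots> \<le> C * m x"
        using K[OF True] m_pos[OF x] by (intro mult_right_mono) (auto simp: C_def)
      finally show ?thesis .
    next
      \<comment> \<open>Off the boundary the whole row of \<open>w\<close> vanishes, so the bound on
        \<open>X3\<close> extends to all of \<open>X\<close>.\<close>
      case False
      have "infsum (w x) X = 0"
        by (rule infsum_0) (use w_X3 x False in blast)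
      then show ?thesis using m_pos[OF x] by (simp add: C_def)
    qed
  next
    show "Y \<subseteq> X" using assms(3,4) Y by auto
    fix x y assume "x \<in> Y" "y \<in> X"
    then show "w x y = (if y \<in> Y then 0 else b x y)"
      using Y assms(3,4) w_eq[of x y] by auto
  next
    fix x y assume xy: "x \<in> X" "y \<in> X"
    show "b x y = b y x" using xy by (rule b_sym)
    show "w x y = w y x" using w_eq xy b_sym[OF xy] by auto
    show "w x y \<ge> 0" using w_eq xy b_nonneg[OF xy] by simp
  qed (use assms(2) m_pos b_summable in \<open>auto simp: C_def\<close>)
  interpret X1: cut_graph X m b w C X1 by (rule cut) simp
  interpret X2: cut_graph X m b w C X2 by (rule cut) simp
  have "cut_graph X m b w C (X - X1)" using X2.cut_graph_axioms assms(4) by simp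
  from symmetric_adjoint_union[OF X1.cut_graph_axioms this]
  have "symmetric_operator X m (adjoint_operator X m (minimal_laplacian X b m)) \<longleftrightarrow>
      symmetric_operator X1 m (adjoint_operator X1 m (minimal_laplacian X1 b m)) \<and>
      symmetric_operator X2 m (adjoint_operator X2 m (minimal_laplacian X2 b m))"
    using X1.symmetric_adjoint_subgraph X2.symmetric_adjoint_subgraph assms(4) by blast
  then show ?thesis
    by (simp only: X1.essentially_self_adjoint_minimal_laplacian_iff
      square_summable_graph.essentially_self_adjoint_minimal_laplacian_iff[OF X1.square_summable_Y]
      square_summable_graph.essentially_self_adjoint_minimal_laplacian_iff[OF X2.square_summable_Y])
qed

end
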